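(* For a given payload $p$, consider the optimization problem $$\min_{\mathbb{P}(V(1)),\ldots,\mathbb{P}(V(T))}\ \mathbb{E}\Big[\sum_{t=1}^{T}V(t)\Big]\quad\text{subject to}\quad\sum_{t=1}^{T}H(V(t))\ge Tp,$$ where the minimum is over sets of (pseudo) marginal distributions of $V(1),\ldots,V(T)$ on $\{0,1,\ldots,K-1\}$, and whose optimal distributions take the form $$\mathbb{P}(V(t)=j)=\frac{\exp(-\beta_t j)}{\sum_{s=0}^{K-1}\exp(-\beta_t s)}$$ for certain parameters $\beta_t>0$. In the solution to this problem, $$\beta_1=\beta_2=\cdots=\beta_t=\cdots=\beta_T=\beta.$$ Therefore, the coding efficiency $c$ satisfies $$c\le\frac{\alpha\,\mathrm{rate}(\beta)}{\mathrm{cost}(\beta)}.$$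
   Context: A memory block has $N$ memory cells, each at one of the states $0,1,\ldots,K-1$. After one erase operation all cells are at the state $K-1$; during each programming process the state of each cell can be decreased but never increased. The block is reliably used for $T$ rounds of information recording between two consecutive erase operations, in which statistically independent messages $M(1),\ldots,M(T)$ are recorded. The data rate in round $t$ is $l(t)=\log_2(|M(t)|)/N$, where $|M(t)|$ is the alphabet size of $M(t)$. The payload $p$ and the coding efficiency $c$ are $$p=\frac1T\sum_{t=1}^{T}l(t),\qquad c=\frac{\alpha}{K}\sum_{t=1}^{T}l(t),$$ where $\alpha$ is a constant depending on the type of the memory block. For a parameter $\beta>0$, $\mathrm{cost}(\beta)=\mathbb{E}[V]$ and $\mathrm{rate}(\beta)=H(V)$, where $V$ takes values in $\{0,\ldots,K-1\}$ with $\mathbb{P}(V=j)=\exp(-\beta j)/\sum_{s=0}^{K-1}\exp(-\beta s)$. Thus $\mathrm{cost}(\beta)=\sum_{j=0}^{K-1}j\exp(-\beta j)\big/\sum_{s=0}^{K-1}\exp(-\beta s)$. $H$ denotes entropy, in the same unit (bits) as the rates $l(t)$. *)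

theory Defs
  imports "HOL-Probability.Probability"
begin

section \<open>Marginals, entropy and truncated exponential distributions\<close>

text \<open>Entropy in bits of a law on the natural numbers, i.e. of the identity random variable.\<close>

definition pmf_entropy :: "nat pmf \<Rightarrow> real" where
  "pmf_entropy q = prob_space.entropy (measure_pmf q) 2 (count_space UNIV) (\<lambda>x. x)"

lemma pmf_entropy_eq_sum:
  assumes "set_pmf q \<subseteq> {..<K}"
  shows "pmf_entropy q = - (\<Sum>j<K. pmf q j * log 2 (pmf q j))"
proof -
  interpret information_space "measure_pmf q" 2
    by (intro information_space.intro measure_pmf.prob_space_axioms
        information_space_axioms.intro) simp
  have "distributed (measure_pmf q) (count_space UNIV) (\<lambda>x. x) (\<lambda>x. ennreal (pmf q x))"
    by (simp add: distributed_def distr_id2 measure_pmf_eq_density[symmetric] distr_id)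
  then have "pmf_entropy q = - (\<integral>x. pmf q x * log 2 (pmf q x) \<partial>count_space UNIV)"
    unfolding pmf_entropy_def by (rule entropy_distr) simp
  also have "(\<integral>x. pmf q x * log 2 (pmf q x) \<partial>count_space UNIV) =
             (\<Sum>j<K. pmf q j * log 2 (pmf q j))"
  proof -
    have z: "{x. pmf q x * log 2 (pmf q x) \<noteq> 0} \<subseteq> {..<K}"
      using assms by (auto simp: set_pmf_eq)
    have f: "finite {x. pmf q x * log 2 (pmf q x) \<noteq> 0}"
      by (rule finite_subset[OF z]) simp
    show ?thesis
      using f by (subst lebesgue_integral_count_space_finite_support)
        (auto intro!: sum.mono_neutral_left z[THEN subsetD])
  qed
  finally show ?thesis .
qed

definition gibbs :: "nat \<Rightarrow> real \<Rightarrow> nat pmf" where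
  "gibbs K \<beta> = embed_pmf (\<lambda>j. if j < K
      then exp (- \<beta> * real j) / (\<Sum>s<K. exp (- \<beta> * real s)) else 0)"

lemma pmf_gibbs:
  assumes "0 < K"
  shows "pmf (gibbs K \<beta>) j =
    (if j < K then exp (- \<beta> * real j) / (\<Sum>s<K. exp (- \<beta> * real s)) else 0)"
proof -
  let ?Z = "\<Sum>s<K. exp (- \<beta> * real s)"
  let ?f = "\<lambda>j. if j < K then exp (- \<beta> * real j) / ?Z else 0"
  have Z: "0 < ?Z"
    using assms by (intro sum_pos) auto
  have nn: "0 \<le> ?f x" for x
    using Z by simp
  have "(\<integral>\<^sup>+x. ennreal (?f x) \<partial>count_space UNIV) = (\<Sum>x<K. ennreal (?f x))"
    by (rule nn_integral_count_space'[of "{..<K}"]) auto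
  also have "\<dots> = ennreal (\<Sum>x<K. ?f x)"
    by (rule sum_ennreal) (rule nn)
  also have "(\<Sum>x<K. ?f x) = 1"
    using Z by (simp add: sum_divide_distrib[symmetric])
  finally have "(\<integral>\<^sup>+x. ennreal (?f x) \<partial>count_space UNIV) = 1" by simp
  then show ?thesis
    unfolding gibbs_def by (subst pmf_embed_pmf) (use nn in auto)
qed

definition cost :: "nat \<Rightarrow> real \<Rightarrow> real" where
  "cost K \<beta> = measure_pmf.expectation (gibbs K \<beta>) real"

lemma cost_eq:
  assumes "0 < K"
  shows "cost K \<beta> =
    (\<Sum>j<K. real j * exp (- \<beta> * real j)) / (\<Sum>s<K. exp (- \<beta> * real s))"
proof -
  have "set_pmf (gibbs K \<beta>) \<subseteq> {..<K}"
    using assms by (auto simp: set_pmf_eq pmf_gibbs split: if_splits)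
  then have "cost K \<beta> = (\<Sum>j<K. real j * pmf (gibbs K \<beta>) j)"
    unfolding cost_def by (intro integral_measure_pmf_real) auto
  also have "\<dots> = (\<Sum>j<K. real j * exp (- \<beta> * real j) / (\<Sum>s<K. exp (- \<beta> * real s)))"
    using assms by (intro sum.cong) (auto simp: pmf_gibbs)
  finally show ?thesis by (simp add: sum_divide_distrib)
qed

definition rate :: "nat \<Rightarrow> real \<Rightarrow> real" where
  "rate K \<beta> = pmf_entropy (gibbs K \<beta>)"


section \<open>The optimization problem\<close>

text \<open>Only the marginal laws \<open>V 1, \<dots>, V T\<close> are optimized over. The values of \<open>V\<close> outside
  \<open>{1..T}\<close> are irrelevant. By linearity, the expectation of the sum is the sum of the
  expectations of the marginals, for any joint law.\<close>

definition total_cost :: "nat \<Rightarrow> (nat \<Rightarrow> nat pmf) \<Rightarrow> real" where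
  "total_cost T V = (\<Sum>t=1..T. measure_pmf.expectation (V t) real)"

definition feasible :: "nat \<Rightarrow> nat \<Rightarrow> real \<Rightarrow> (nat \<Rightarrow> nat pmf) \<Rightarrow> bool" where
  "feasible K T p V \<longleftrightarrow>
     (\<forall>t\<in>{1..T}. set_pmf (V t) \<subseteq> {..<K}) \<and> real T * p \<le> (\<Sum>t=1..T. pmf_entropy (V t))"

definition optimal :: "nat \<Rightarrow> nat \<Rightarrow> real \<Rightarrow> (nat \<Rightarrow> nat pmf) \<Rightarrow> bool" where
  "optimal K T p V \<longleftrightarrow> is_arg_min (total_cost T) (feasible K T p) V"


section \<open>Memory blocks\<close>

text \<open>\<open>S t n\<close> is the state of cell \<open>n\<close> after round \<open>t\<close>, and \<open>S 0 n\<close> its state after the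
  erase operation. The writer may be randomized, and nothing is assumed about which messages
  it knows in which round.\<close>

locale memory_block_use = prob_space \<Omega> for \<Omega> :: "'a measure" +
  fixes N K T :: nat
    and A :: "nat \<Rightarrow> 'm set"
    and M :: "nat \<Rightarrow> 'a \<Rightarrow> 'm"
    and S :: "nat \<Rightarrow> nat \<Rightarrow> 'a \<Rightarrow> nat"
  assumes cells: "0 < N"
    and alphabet: "t \<in> {1..T} \<Longrightarrow> finite (A t) \<and> A t \<noteq> {}"
    and message_uniform:
      "t \<in> {1..T} \<Longrightarrow> distr \<Omega> (count_space (A t)) (M t) = uniform_count_measure (A t)"
    and messages_indep: "indep_vars (\<lambda>t. count_space (A t)) M {1..T}"
    and state_measurable:
      "t \<le> T \<Longrightarrow> n < N \<Longrightarrow> S t n \<in> measurable \<Omega> (count_space UNIV)"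
    and erased: "n < N \<Longrightarrow> \<omega> \<in> space \<Omega> \<Longrightarrow> S 0 n \<omega> = K - 1"
    and decreasing: "t < T \<Longrightarrow> n < N \<Longrightarrow> \<omega> \<in> space \<Omega> \<Longrightarrow> S (Suc t) n \<omega> \<le> S t n \<omega>"

text \<open>The reader in round \<open>t\<close> sees the current states of the \<open>N\<close> cells and nothing else.\<close>

definition error_prob ::
  "'a measure \<Rightarrow> nat \<Rightarrow> (nat \<Rightarrow> 'a \<Rightarrow> 'm) \<Rightarrow> (nat \<Rightarrow> nat \<Rightarrow> 'a \<Rightarrow> nat)
    \<Rightarrow> (nat \<Rightarrow> (nat \<Rightarrow> nat) \<Rightarrow> 'm) \<Rightarrow> nat \<Rightarrow> real" where
  "error_prob \<Omega> N M S dec t =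
     measure \<Omega> {\<omega> \<in> space \<Omega>. dec t (\<lambda>n\<in>{..<N}. S t n \<omega>) \<noteq> M t \<omega>}"

definition data_rate :: "nat \<Rightarrow> (nat \<Rightarrow> 'm set) \<Rightarrow> nat \<Rightarrow> real" where
  "data_rate N A t = log 2 (real (card (A t))) / real N"

text \<open>Reliability is in the usual asymptotic sense: a sequence of block uses whose error
  probabilities vanish and whose data rates converge to \<open>l\<close>. A single block that is always
  read correctly is the case of a constant sequence, with \<open>l = data_rate N A\<close>.\<close>

definition reliably_used ::
  "nat \<Rightarrow> nat \<Rightarrow> (nat \<Rightarrow> 'a measure) \<Rightarrow> (nat \<Rightarrow> nat) \<Rightarrow> (nat \<Rightarrow> nat \<Rightarrow> 'm set)
    \<Rightarrow> (nat \<Rightarrow> nat \<Rightarrow> 'a \<Rightarrow> 'm) \<Rightarrow> (nat \<Rightarrow> nat \<Rightarrow> nat \<Rightarrow> 'a \<Rightarrow> nat)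
    \<Rightarrow> (nat \<Rightarrow> nat \<Rightarrow> (nat \<Rightarrow> nat) \<Rightarrow> 'm) \<Rightarrow> (nat \<Rightarrow> real) \<Rightarrow> bool" where
  "reliably_used K T \<Omega> N A M S dec l \<longleftrightarrow>
     (\<forall>i. memory_block_use (\<Omega> i) (N i) K T (A i) (M i) (S i)) \<and>
     (\<forall>t\<in>{1..T}. (\<lambda>i. error_prob (\<Omega> i) (N i) (M i) (S i) (dec i) t) \<longlonglongrightarrow> 0) \<and>
     (\<forall>t\<in>{1..T}. (\<lambda>i. data_rate (N i) (A i) t) \<longlonglongrightarrow> l t)"

definition payload :: "nat \<Rightarrow> (nat \<Rightarrow> real) \<Rightarrow> real" where
  "payload T l = 1 / real T * (\<Sum>t=1..T. l t)"

definition coding_efficiency :: "real \<Rightarrow> nat \<Rightarrow> nat \<Rightarrow> (nat \<Rightarrow> real) \<Rightarrow> real" where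
  "coding_efficiency \<alpha> K T l = \<alpha> / real K * (\<Sum>t=1..T. l t)"

end

theory Submission
  imports Defs "HOL-Real_Asymp.Real_Asymp"
begin

text \<open>The optimization problem is solved by Lagrangian duality. By Gibbs' inequality,
  \<open>H(q) ln 2 \<le> \<beta> E q + ln Z(\<beta>)\<close> for every law \<open>q\<close> on \<open>{0, \<dots>, K - 1}\<close>, with equality only
  for the truncated exponential law with parameter \<open>\<beta>\<close>. Summing over the rounds, with the
  \<open>\<beta>\<close> for which \<open>rate(\<beta>) = p\<close>, gives total cost at least \<open>T cost(\<beta>)\<close>, with equality only
  if every marginal is that law.

  For the coding efficiency it remains to see that \<open>T cost(\<beta>) \<le> K - 1\<close>. In a block of \<open>N\<close>
  cells, each cell follows one of \<open>D\<close> sequences of drops, where a sequence has sum at most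
  \<open>K - 1\<close>; weighting the sequences by \<open>exp(-\<beta> \<Sum>d)\<close> gives \<open>D \<le> exp(\<beta>(K - 1)) Z(\<beta>)^T\<close>.
  The message tuple is uniform and is recovered from the states up to a vanishing error,
  whence \<open>T p ln 2 \<le> ln D \<le> \<beta>(K - 1) + T ln Z(\<beta>)\<close>, while \<open>p ln 2 = \<beta> cost(\<beta>) + ln Z(\<beta>)\<close>.\<close>

section \<open>Partition function and Gibbs' inequality\<close>

definition partition_fun :: "nat \<Rightarrow> real \<Rightarrow> real" where
  "partition_fun K \<beta> = (\<Sum>s<K. exp (- \<beta> * real s))"

lemma partition_fun_pos: "0 < K \<Longrightarrow> 0 < partition_fun K \<beta>"
  unfolding partition_fun_def by (intro sum_pos) auto

lemma pmf_gibbs_eq: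
  "j < K \<Longrightarrow> pmf (gibbs K \<beta>) j = exp (- \<beta> * real j) / partition_fun K \<beta>"
  by (simp add: pmf_gibbs partition_fun_def)

lemma set_pmf_gibbs: "0 < K \<Longrightarrow> set_pmf (gibbs K \<beta>) = {..<K}"
  using partition_fun_pos[of K \<beta>]
  by (auto simp: set_pmf_eq pmf_gibbs partition_fun_def split: if_splits)

lemma expectation_real_eq_sum:
  "set_pmf q \<subseteq> {..<K} \<Longrightarrow> measure_pmf.expectation q real = (\<Sum>j<K. real j * pmf q j)"
  by (intro integral_measure_pmf_real) auto

lemma sum_pmf_lessThan: "set_pmf (q :: nat pmf) \<subseteq> {..<K} \<Longrightarrow> (\<Sum>j<K. pmf q j) = 1"
  by (intro sum_pmf_eq_1) auto

text \<open>This is \<open>ln x \<le> x - 1\<close> at \<open>x = g / q\<close>, multiplied by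
  \<open>q\<close>. The summand \<open>g - q\<close> gives every term a sign of its own; summed over
  two probability laws it cancels.\<close>

lemma relative_entropy_term_nonneg:
  fixes q g :: real
  assumes "0 \<le> q" "0 < g"
  shows "0 \<le> g - q - q * (ln g - ln q)"
proof (cases "q = 0")
  case False
  have "ln (g / q) \<le> g / q - 1"
    using assms False by (intro ln_le_minus_one) simp
  then have "q * (ln g - ln q) \<le> q * (g / q - 1)"
    using assms False by (intro mult_left_mono) (simp_all add: ln_div)
  also have "\<dots> = g - q" using False by (simp add: field_simps)
  finally show ?thesis by simp
qed (use assms in simp)

text \<open>Equality in \<open>ln x \<le> x - 1\<close> forces \<open>x = 1\<close>. For
  \<open>q = 0\<close> the term would be \<open>g > 0\<close>.\<close>

lemma relative_entropy_term_eq_0: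
  fixes q g :: real
  assumes "0 \<le> q" "0 < g" "g - q - q * (ln g - ln q) = 0"
  shows "q = g"
proof (cases "q = 0")
  case False
  have "q * (ln (g / q) - (g / q - 1)) = 0"
    using assms False by (simp add: ln_div field_simps)
  then have "g / q = 1"
    using assms False by (intro ln_eq_minus_one) auto
  then show ?thesis using False by simp
qed (use assms in simp)

text \<open>The right-hand side is the relative entropy, in nats, of \<open>q\<close> with respect
  to the Gibbs law. The logarithm of a Gibbs mass is affine in \<open>j\<close>, so the cross term
  reduces to the expectation of \<open>q\<close> and a constant.\<close>

lemma gibbs_slack:
  assumes "0 < K" "set_pmf q \<subseteq> {..<K}"
  shows "\<beta> * measure_pmf.expectation q real + ln (partition_fun K \<beta>) - pmf_entropy q * ln 2 =
    (\<Sum>j<K. pmf (gibbs K \<beta>) j - pmf q j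
       - pmf q j * (ln (pmf (gibbs K \<beta>) j) - ln (pmf q j)))"
proof -
  let ?Z = "partition_fun K \<beta>"
  have Z: "0 < ?Z" using assms(1) by (rule partition_fun_pos)
  have H: "pmf_entropy q * ln 2 = - (\<Sum>j<K. pmf q j * ln (pmf q j))"
    using assms(2) by (simp add: pmf_entropy_eq_sum log_def sum_distrib_right)
  have lng: "ln (pmf (gibbs K \<beta>) j) = - \<beta> * real j - ln ?Z" if "j < K" for j
    using that Z by (simp add: pmf_gibbs_eq ln_div)
  have "(\<Sum>j<K. pmf (gibbs K \<beta>) j - pmf q j
       - pmf q j * (ln (pmf (gibbs K \<beta>) j) - ln (pmf q j))) =
     (\<Sum>j<K. pmf (gibbs K \<beta>) j - pmf q j
       + (\<beta> * (real j * pmf q j) + pmf q j * ln ?Z + pmf q j * ln (pmf q j)))"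
    by (intro sum.cong refl) (simp add: lng algebra_simps)
  also have "\<dots> = \<beta> * (\<Sum>j<K. real j * pmf q j) + ln ?Z + (\<Sum>j<K. pmf q j * ln (pmf q j))"
    using assms
    by (simp add: sum.distrib sum_subtractf sum_distrib_left[symmetric]
        sum_distrib_right[symmetric] sum_pmf_lessThan set_pmf_gibbs)
  finally show ?thesis
    using assms(2) by (simp add: H expectation_real_eq_sum)
qed

lemma gibbs_inequality:
  assumes "0 < K" "set_pmf q \<subseteq> {..<K}"
  shows "pmf_entropy q * ln 2 \<le>
    \<beta> * measure_pmf.expectation q real + ln (partition_fun K \<beta>)"
proof -
  have "0 < pmf (gibbs K \<beta>) j" if "j < K" for j
    using that assms(1) by (simp add: pmf_positive set_pmf_gibbs)
  then have "0 \<le> (\<Sum>j<K. pmf (gibbs K \<beta>) j - pmf q j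
       - pmf q j * (ln (pmf (gibbs K \<beta>) j) - ln (pmf q j)))"
    by (intro sum_nonneg relative_entropy_term_nonneg) simp_all
  then show ?thesis
    using gibbs_slack[OF assms, of \<beta>] by simp
qed

text \<open>With zero slack, every nonnegative term in \<open>gibbs_slack\<close> vanishes, so the
  masses agree below \<open>K\<close>; from \<open>K\<close> on both are 0.\<close>

lemma gibbs_equality_imp:
  assumes "0 < K" "set_pmf q \<subseteq> {..<K}"
    and "pmf_entropy q * ln 2 = \<beta> * measure_pmf.expectation q real + ln (partition_fun K \<beta>)"
  shows "q = gibbs K \<beta>"
proof (rule pmf_eqI)
  fix j
  let ?h = "\<lambda>j. pmf (gibbs K \<beta>) j - pmf q j
       - pmf q j * (ln (pmf (gibbs K \<beta>) j) - ln (pmf q j))"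
  have g: "0 < pmf (gibbs K \<beta>) j" if "j < K" for j
    using that assms(1) by (simp add: pmf_positive set_pmf_gibbs)
  have nn: "0 \<le> ?h j" if "j \<in> {..<K}" for j
    using that g by (intro relative_entropy_term_nonneg) simp_all
  have "sum ?h {..<K} = 0"
    using gibbs_slack[OF assms(1,2), of \<beta>] assms(3) by simp
  then have h0: "\<forall>j\<in>{..<K}. ?h j = 0"
    by (subst (asm) sum_nonneg_eq_0_iff[OF finite_lessThan nn])
  show "pmf q j = pmf (gibbs K \<beta>) j"
  proof (cases "j < K")
    case True
    then show ?thesis
      using h0 by (intro relative_entropy_term_eq_0[OF _ g]) simp_all
  next
    case False
    then have "j \<notin> set_pmf q" using assms(2) by auto
    then show ?thesis
      using False assms(1) by (simp add: set_pmf_iff pmf_gibbs)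
  qed
qed

section \<open>Rate and cost as functions of the parameter\<close>

lemma rate_eq: "0 < K \<Longrightarrow> rate K \<beta> * ln 2 = \<beta> * cost K \<beta> + ln (partition_fun K \<beta>)"
  \<comment> \<open>The relative entropy of the Gibbs law with respect to itself is 0.\<close>
  using gibbs_slack[of K "gibbs K \<beta>" \<beta>] by (simp add: rate_def cost_def set_pmf_gibbs)

lemma cost_pos:
  assumes "2 \<le> K" shows "0 < cost K \<beta>"
proof -
  have "0 < (\<Sum>j<K. real j * exp (- \<beta> * real j))"
    using assms by (intro sum_pos2[of _ 1]) auto
  then show ?thesis
    using assms partition_fun_pos[of K \<beta>] by (simp add: cost_eq partition_fun_def)
qed

text \<open>The ratio of the masses at 1 and 0 recovers the parameter; \<open>2 \<le> K\<close> puts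
  1 into the support.\<close>

lemma gibbs_inject:
  assumes "2 \<le> K" "gibbs K a = gibbs K b"
  shows "a = b"
proof -
  have r: "pmf (gibbs K \<beta>) 1 / pmf (gibbs K \<beta>) 0 = exp (- \<beta>)" for \<beta>
    using assms(1) partition_fun_pos[of K \<beta>] by (simp add: pmf_gibbs partition_fun_def)
  show ?thesis using r[of a] r[of b] assms(2) by simp
qed

text \<open>Parameter 0 gives the uniform law, whose partition function is \<open>K\<close>, so
  Gibbs' inequality there bounds the entropy by that of the uniform law. It is strict because
  another parameter gives another law.\<close>

lemma rate_less_log:
  assumes "2 \<le> K" "0 < \<beta>"
  shows "rate K \<beta> < log 2 (real K)"
proof -
  have K: "0 < K" using assms by simp
  have "gibbs K \<beta> \<noteq> gibbs K 0" using gibbs_inject[OF assms(1)] assms(2) by auto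
  then have "pmf_entropy (gibbs K \<beta>) * ln 2 \<noteq>
      0 * measure_pmf.expectation (gibbs K \<beta>) real + ln (partition_fun K 0)"
    using gibbs_equality_imp[OF K, of "gibbs K \<beta>" 0] set_pmf_gibbs[OF K] by auto
  with gibbs_inequality[OF K, of "gibbs K \<beta>" 0]
  have "rate K \<beta> * ln 2 < ln (real K)"
    using set_pmf_gibbs[OF K] by (simp add: rate_def partition_fun_def)
  then show ?thesis by (simp add: log_def field_simps)
qed

text \<open>The rate is continuous, equals \<open>log 2 K\<close> at 0 and tends to 0 at infinity,
  so the intermediate value theorem applies.\<close>

lemma ex_rate_eq:
  assumes "2 \<le> K" "0 < p" "p < log 2 (real K)"
  shows "\<exists>\<beta>>0. rate K \<beta> = p"
proof -
  \<comment> \<open>\<open>r\<close> is the rate in nats, with the factor \<beta> moved inside the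
    sum so that the limit at infinity can be taken term by term.\<close>
  define r where "r = (\<lambda>\<beta>. (\<Sum>j<K. \<beta> * (real j * exp (- \<beta> * real j))) / partition_fun K \<beta>
    + ln (partition_fun K \<beta>))"
  have K: "0 < K" using assms by simp
  have r: "rate K \<beta> * ln 2 = r \<beta>" for \<beta>
    using rate_eq[OF K, of \<beta>] K by (simp add: r_def cost_eq partition_fun_def sum_distrib_left)
  have term0: "((\<lambda>\<beta>. \<beta> * (real j * exp (- \<beta> * real j))) \<longlongrightarrow> 0) at_top" for j
  proof (cases "j = 0")
    case False
    then have "0 < real j" by simp
    then show ?thesis by real_asymp
  qed simp
  have exp_lim: "((\<lambda>\<beta>. exp (- \<beta> * real j)) \<longlongrightarrow> of_bool (j = 0)) at_top" for j
  proof (cases "j = 0")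
    case False
    then have "0 < real j" by simp
    then show ?thesis using False by simp real_asymp
  qed simp
  \<comment> \<open>Only the summand for \<open>s = 0\<close> survives in the limit.\<close>
  have "(partition_fun K \<longlongrightarrow> (\<Sum>j<K. of_bool (j = 0))) at_top"
    unfolding partition_fun_def by (intro tendsto_sum exp_lim)
  also have "(\<Sum>j<K. of_bool (j = 0)) = (1::real)"
    using K by (simp add: of_bool_def sum.delta)
  finally have Z: "(partition_fun K \<longlongrightarrow> 1) at_top" .
  have "(r \<longlongrightarrow> (\<Sum>j<K. 0) / 1 + ln 1) at_top"
    unfolding r_def by (intro tendsto_intros term0 Z) auto
  then have "(r \<longlongrightarrow> 0) at_top" by simp
  then have "\<forall>\<^sub>F \<beta> in at_top. r \<beta> < p * ln 2"
    using assms(2) by (intro order_tendstoD(2)) auto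
  then have "\<forall>\<^sub>F \<beta> in at_top. r \<beta> < p * ln 2 \<and> 0 < \<beta>"
    using eventually_gt_at_top[of "0::real"] by eventually_elim auto
  then obtain B where B: "r B < p * ln 2" "0 < B"
    using eventually_happens'[OF trivial_limit_at_top_linorder] by blast
  have r0: "p * ln 2 < r 0"
    using assms by (simp add: r_def partition_fun_def log_def field_simps)
  have "\<exists>x\<ge>0. x \<le> B \<and> r x = p * ln 2"
    unfolding r_def
  proof (rule IVT2')
    show "continuous_on {0..B} (\<lambda>\<beta>. (\<Sum>j<K. \<beta> * (real j * exp (- \<beta> * real j)))
        / partition_fun K \<beta> + ln (partition_fun K \<beta>))"
      using partition_fun_pos[OF K] unfolding partition_fun_def
      by (intro continuous_intros) (auto simp: less_imp_neq[symmetric])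
  qed (use B r0 in \<open>auto simp: r_def\<close>)
  then obtain x where x: "0 \<le> x" "r x = p * ln 2" by blast
  with r0 have "0 < x" by (cases "x = 0") auto
  then show ?thesis using x(2) r[of x] by (intro exI[of _ x]) simp
qed

section \<open>Solution of the optimization problem\<close>

lemma feasible_const_gibbs:
  assumes "0 < K" "rate K \<beta> = p"
  shows "feasible K T p (\<lambda>_. gibbs K \<beta>)"
  using assms set_pmf_gibbs[OF assms(1), of \<beta>] by (simp add: feasible_def rate_def)

text \<open>Weak duality: Gibbs' inequality is summed over the rounds and combined with the entropy
  constraint, \<beta> being the inverse multiplier.\<close>

lemma sum_lagrangian_ge:
  assumes "0 < K" "feasible K T p V"
  shows "real T * p * ln 2 \<le> \<beta> * total_cost T V + real T * ln (partition_fun K \<beta>)"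
proof -
  have "real T * p * ln 2 \<le> (\<Sum>t=1..T. pmf_entropy (V t)) * ln 2"
    using assms(2) by (auto simp: feasible_def)
  also have "\<dots> \<le> (\<Sum>t=1..T. \<beta> * measure_pmf.expectation (V t) real + ln (partition_fun K \<beta>))"
    unfolding sum_distrib_right
    using assms by (intro sum_mono gibbs_inequality) (auto simp: feasible_def)
  finally show ?thesis
    by (simp add: sum.distrib total_cost_def sum_distrib_left)
qed

text \<open>When the rate at \<beta> is \<open>p\<close>, \<open>rate_eq\<close> makes the
  logarithms of the partition function cancel in the dual bound, and \<beta> can be divided
  out.\<close>

lemma total_cost_ge:
  assumes "0 < K" "0 < \<beta>" "rate K \<beta> = p" "feasible K T p V"
  shows "real T * cost K \<beta> \<le> total_cost T V"
proof -
  have "real T * (\<beta> * cost K \<beta> + ln (partition_fun K \<beta>)) = real T * p * ln 2"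
    using rate_eq[OF assms(1), of \<beta>] assms(3) by simp
  with sum_lagrangian_ge[OF assms(1,4), of \<beta>]
  have "\<beta> * (real T * cost K \<beta>) \<le> \<beta> * total_cost T V"
    by (simp add: algebra_simps)
  then show ?thesis using assms(2) by simp
qed

text \<open>At minimal cost the slacks of Gibbs' inequality in the single rounds have a sum that
  feasibility makes at most 0. Being nonnegative, each is 0, and the equality case applies.\<close>

lemma total_cost_minimal_imp_gibbs:
  assumes "0 < K" "rate K \<beta> = p" "feasible K T p V"
    and "total_cost T V = real T * cost K \<beta>" "t \<in> {1..T}"
  shows "V t = gibbs K \<beta>"
proof -
  let ?f = "\<lambda>t. \<beta> * measure_pmf.expectation (V t) real + ln (partition_fun K \<beta>)
    - pmf_entropy (V t) * ln 2"
  have s: "set_pmf (V t) \<subseteq> {..<K}" if "t \<in> {1..T}" for t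
    using assms(3) that by (auto simp: feasible_def)
  have nn: "0 \<le> ?f t" if "t \<in> {1..T}" for t
    using gibbs_inequality[OF assms(1) s[OF that], of \<beta>] by simp
  have "(\<Sum>t=1..T. ?f t) = \<beta> * total_cost T V + real T * ln (partition_fun K \<beta>)
      - (\<Sum>t=1..T. pmf_entropy (V t)) * ln 2"
    by (simp add: sum.distrib sum_subtractf total_cost_def sum_distrib_left sum_distrib_right)
  also have "\<dots> = real T * p * ln 2 - (\<Sum>t=1..T. pmf_entropy (V t)) * ln 2"
  proof -
    have "\<beta> * total_cost T V + real T * ln (partition_fun K \<beta>) =
        real T * (\<beta> * cost K \<beta> + ln (partition_fun K \<beta>))"
      using assms(4) by (simp add: algebra_simps)
    then show ?thesis
      using rate_eq[OF assms(1), of \<beta>] assms(2) by simp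
  qed
  also have "\<dots> \<le> 0"
    using assms(3) by (auto simp: feasible_def)
  finally have "(\<Sum>t=1..T. ?f t) = 0"
    using nn by (intro antisym sum_nonneg) auto
  then have "?f t = 0"
    using nn assms(5) by (subst (asm) sum_nonneg_eq_0_iff) auto
  then show ?thesis
    by (intro gibbs_equality_imp assms s) simp
qed

lemma optimal_const_gibbs:
  assumes "0 < K" "0 < \<beta>" "rate K \<beta> = p"
  shows "optimal K T p (\<lambda>_. gibbs K \<beta>)"
  using feasible_const_gibbs[OF assms(1,3)] total_cost_ge[OF assms]
  by (force simp: optimal_def is_arg_min_def total_cost_def cost_def[symmetric])

lemma optimal_imp_gibbs:
  assumes "0 < K" "0 < \<beta>" "rate K \<beta> = p" "optimal K T p V" "t \<in> {1..T}"
  shows "V t = gibbs K \<beta>"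
proof -
  have V: "feasible K T p V"
    using assms(4) by (simp add: optimal_def is_arg_min_def)
  have "total_cost T V \<le> total_cost T (\<lambda>_. gibbs K \<beta>)"
    using assms(4) feasible_const_gibbs[OF assms(1,3), of T]
    by (force simp: optimal_def is_arg_min_def)
  also have "\<dots> = real T * cost K \<beta>"
    by (simp add: total_cost_def cost_def)
  finally have "total_cost T V = real T * cost K \<beta>"
    using total_cost_ge[OF assms(1-3) V] by simp
  then show ?thesis
    by (rule total_cost_minimal_imp_gibbs[OF assms(1,3) V _ assms(5)])
qed

text \<open>For \<open>p \<le> 0\<close> the point mass at 0 would be feasible at cost 0, whereas
  Gibbs laws have positive cost. Together with the next lemma this derives the range of
  \<open>p\<close> required by \<open>ex_rate_eq\<close> from the form of the optimum.\<close>

lemma optimal_gibbs_imp_payload_pos: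
  assumes "2 \<le> K" "1 \<le> T" "optimal K T p V" "\<forall>t\<in>{1..T}. V t = gibbs K (b t)"
  shows "0 < p"
proof (rule ccontr)
  assume "\<not> 0 < p"
  then have p: "real T * p \<le> 0" by (simp add: mult_nonneg_nonpos)
  have "pmf_entropy (return_pmf 0) = 0"
    by (subst pmf_entropy_eq_sum[of _ 1]) auto
  with p have "feasible K T p (\<lambda>_. return_pmf 0)"
    using assms(1) by (simp add: feasible_def)
  then have "total_cost T V \<le> total_cost T (\<lambda>_. return_pmf 0)"
    using assms(3) by (force simp: optimal_def is_arg_min_def)
  also have "\<dots> = 0" by (simp add: total_cost_def)
  also have "0 < (\<Sum>t=1..T. cost K (b t))"
    using assms(1,2) by (intro sum_pos cost_pos) auto
  also have "\<dots> = total_cost T V"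
    using assms(4) by (simp add: total_cost_def cost_def)
  finally show False by simp
qed

lemma optimal_gibbs_imp_payload_less:
  assumes "2 \<le> K" "1 \<le> T" "optimal K T p V" "\<forall>t\<in>{1..T}. 0 < b t \<and> V t = gibbs K (b t)"
  shows "p < log 2 (real K)"
proof -
  have "real T * p \<le> (\<Sum>t=1..T. pmf_entropy (V t))"
    using assms(3) by (auto simp: optimal_def is_arg_min_def feasible_def)
  also have "\<dots> = (\<Sum>t=1..T. rate K (b t))"
    using assms(4) by (simp add: rate_def)
  also have "\<dots> < (\<Sum>t=1..T. log 2 (real K))"
    using assms by (intro sum_strict_mono rate_less_log) auto
  finally show ?thesis using assms(2) by simp
qed

section \<open>Counting the drop sequences of one cell\<close>

definition drop_sequences :: "nat \<Rightarrow> nat \<Rightarrow> (nat \<Rightarrow> nat) set" where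
  "drop_sequences K T = {d \<in> PiE {..<T} (\<lambda>_. {..<K}). (\<Sum>u<T. d u) \<le> K - 1}"

lemma finite_drop_sequences: "finite (drop_sequences K T)"
  unfolding drop_sequences_def
  by (rule finite_subset[of _ "PiE {..<T} (\<lambda>_. {..<K})"]) (auto intro: finite_PiE)

lemma card_drop_sequences_le:
  assumes "0 \<le> \<beta>"
  shows "real (card (drop_sequences K T)) \<le> exp (\<beta> * real (K - 1)) * partition_fun K \<beta> ^ T"
proof -
  let ?w = "\<lambda>d. \<Prod>u<T. exp (- \<beta> * real (d u))"
  \<comment> \<open>A total drop of at most \<open>K - 1\<close> makes each rescaled weight at least
    1, so the weights dominate the count.\<close>
  have w: "1 \<le> exp (\<beta> * real (K - 1)) * ?w d" if "d \<in> drop_sequences K T" for d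
  proof -
    have "real (\<Sum>u<T. d u) \<le> real (K - 1)"
      using that unfolding drop_sequences_def by (intro of_nat_mono) auto
    then have "\<beta> * real (\<Sum>u<T. d u) \<le> \<beta> * real (K - 1)"
      using assms by (rule mult_left_mono)
    moreover have "?w d = exp (- \<beta> * real (\<Sum>u<T. d u))"
      by (simp only: exp_sum[symmetric] finite_lessThan of_nat_sum sum_distrib_left)
    then have "exp (\<beta> * real (K - 1)) * ?w d =
        exp (\<beta> * real (K - 1) - \<beta> * real (\<Sum>u<T. d u))"
      by (simp only: exp_add[symmetric]) simp
    ultimately show ?thesis by simp
  qed
  have "real (card (drop_sequences K T)) = (\<Sum>d\<in>drop_sequences K T. 1)" by simp
  also have "\<dots> \<le> (\<Sum>d\<in>drop_sequences K T. exp (\<beta> * real (K - 1)) * ?w d)"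
    by (intro sum_mono w)
  \<comment> \<open>Without the constraint on the total drop, the sum of the product weights
    factorizes over the rounds.\<close>
  also have "\<dots> \<le> (\<Sum>d\<in>PiE {..<T} (\<lambda>_. {..<K}). exp (\<beta> * real (K - 1)) * ?w d)"
  proof (rule sum_mono2)
    show "drop_sequences K T \<subseteq> PiE {..<T} (\<lambda>_. {..<K})"
      unfolding drop_sequences_def by blast
  qed (simp_all add: finite_PiE prod_nonneg)
  also have "\<dots> = exp (\<beta> * real (K - 1)) * (\<Prod>u<T. \<Sum>j<K. exp (- \<beta> * real j))"
    by (subst prod_sum_PiE) (simp_all add: sum_distrib_left)
  finally show ?thesis by (simp add: partition_fun_def)
qed

section \<open>State histories of a block and measurability of decoding errors\<close>

context memory_block_use
begin

text \<open>Index \<open>u\<close> stands for round \<open>u + 1\<close>. Truncated subtraction is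
  exact on \<open>space \<Omega>\<close> since states never increase. Both restrictions make the
  value extensional, as membership in \<open>PiE\<close> demands.\<close>

definition state_drops :: "'a \<Rightarrow> nat \<Rightarrow> nat \<Rightarrow> nat" where
  "state_drops \<omega> = (\<lambda>n\<in>{..<N}. \<lambda>u\<in>{..<T}. S u n \<omega> - S (Suc u) n \<omega>)"

lemma state_plus_drops:
  assumes "n < N" "\<omega> \<in> space \<Omega>" "t \<le> T"
  shows "S t n \<omega> + (\<Sum>u<t. state_drops \<omega> n u) = K - 1"
  using assms(3)
proof (induction t)
  case 0
  then show ?case using assms by (simp add: erased)
next
  case (Suc t)
  then show ?case
    using assms decreasing[of t n \<omega>] by (simp add: state_drops_def)
qed

lemma state_eq:
  assumes "n < N" "\<omega> \<in> space \<Omega>" "t \<le> T"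
  shows "S t n \<omega> = K - 1 - (\<Sum>u<t. state_drops \<omega> n u)"
  using state_plus_drops[OF assms] by simp

lemma state_drops_in:
  assumes "0 < K" "\<omega> \<in> space \<Omega>"
  shows "state_drops \<omega> \<in> PiE {..<N} (\<lambda>_. drop_sequences K T)"
proof (rule PiE_I)
  fix n assume "n \<in> {..<N}"
  then have n: "n < N" by simp
  have s: "(\<Sum>u<T. state_drops \<omega> n u) \<le> K - 1"
    using state_plus_drops[OF n assms(2), of T] by simp
  have "state_drops \<omega> n u < K" if "u < T" for u
  proof -
    have "state_drops \<omega> n u \<le> (\<Sum>u<T. state_drops \<omega> n u)"
      using that by (intro member_le_sum) auto
    with s assms(1) show ?thesis by simp
  qed
  then show "state_drops \<omega> n \<in> drop_sequences K T"
    using s n by (auto simp: drop_sequences_def state_drops_def)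
qed (simp add: state_drops_def)

lemma message_measurable: "t \<in> {1..T} \<Longrightarrow> M t \<in> measurable \<Omega> (count_space (A t))"
  using messages_indep by (auto simp: indep_vars_def)

text \<open>State vectors range over a finite set, so it suffices to treat preimages of points. This
  finiteness is what later permits an arbitrary decoding function.\<close>

lemma measurable_state_vector:
  assumes "t \<le> T"
  shows "(\<lambda>\<omega>. \<lambda>n\<in>{..<N}. S t n \<omega>) \<in> measurable \<Omega> (count_space (PiE {..<N} (\<lambda>_. {..K - 1})))"
proof (rule measurable_count_space_eq2[THEN iffD2])
  show "finite (PiE {..<N} (\<lambda>_. {..K - 1}))"
    by (intro finite_PiE) auto
  show "(\<lambda>\<omega>. \<lambda>n\<in>{..<N}. S t n \<omega>) \<in> space \<Omega> \<rightarrow> PiE {..<N} (\<lambda>_. {..K - 1}) \<and>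
    (\<forall>x\<in>PiE {..<N} (\<lambda>_. {..K - 1}). (\<lambda>\<omega>. \<lambda>n\<in>{..<N}. S t n \<omega>) -` {x} \<inter> space \<Omega> \<in> events)"
  proof (intro conjI ballI)
    show "(\<lambda>\<omega>. \<lambda>n\<in>{..<N}. S t n \<omega>) \<in> space \<Omega> \<rightarrow> PiE {..<N} (\<lambda>_. {..K - 1})"
      using assms by (simp add: Pi_iff restrict_PiE_iff state_eq diff_le_mono2)
  next
    fix x assume x: "x \<in> PiE {..<N} (\<lambda>_. {..K - 1})"
    \<comment> \<open>Outside the \<open>N\<close> cells both functions are
      \<open>undefined\<close>, so equality is decided on the cells.\<close>
    have "(\<lambda>\<omega>. \<lambda>n\<in>{..<N}. S t n \<omega>) -` {x} \<inter> space \<Omega> =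
      {\<omega> \<in> space \<Omega>. \<forall>n\<in>{..<N}. S t n \<omega> = x n}"
      using PiE_arb[OF x] by (auto simp: fun_eq_iff)
    also have "\<dots> \<in> events"
    proof (intro sets.sets_Collect_finite_All)
      fix n assume "n \<in> {..<N}"
      then have [measurable]: "S t n \<in> measurable \<Omega> (count_space UNIV)"
        using assms state_measurable by auto
      show "{\<omega> \<in> space \<Omega>. S t n \<omega> = x n} \<in> events" by measurable
    qed simp
    finally show "(\<lambda>\<omega>. \<lambda>n\<in>{..<N}. S t n \<omega>) -` {x} \<inter> space \<Omega> \<in> events" .
  qed
qed

text \<open>The event is split along the finitely many state vectors \<open>x\<close>; on each piece
  the decoder has the constant output \<open>f x\<close>, which leaves a condition on the message
  alone.\<close>

lemma error_event_measurable:
  assumes "t \<in> {1..T}"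
  shows "{\<omega> \<in> space \<Omega>. f (\<lambda>n\<in>{..<N}. S t n \<omega>) \<noteq> M t \<omega>} \<in> events"
proof -
  let ?X = "PiE {..<N} (\<lambda>_. {..K - 1})"
  let ?s = "\<lambda>\<omega>. \<lambda>n\<in>{..<N}. S t n \<omega>"
  have fin: "finite ?X" by (intro finite_PiE) auto
  have X: "?s \<in> measurable \<Omega> (count_space ?X)"
    using assms by (intro measurable_state_vector) auto
  have "{\<omega> \<in> space \<Omega>. f (?s \<omega>) \<noteq> M t \<omega>} =
    (\<Union>x\<in>?X. (?s -` {x} \<inter> space \<Omega>) \<inter> (M t -` (A t - {f x}) \<inter> space \<Omega>))"
    using measurable_space[OF X] measurable_space[OF message_measurable[OF assms]] by auto
  also have "\<dots> \<in> events"
    by (intro sets.finite_UN fin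
        sets.Int[OF measurable_sets[OF X] measurable_sets[OF message_measurable[OF assms]]]) auto
  finally show ?thesis .
qed

section \<open>Counting messages against state histories\<close>

lemma prob_messages_eq_le:
  assumes "1 \<le> T"
  shows "{\<omega> \<in> space \<Omega>. \<forall>t\<in>{1..T}. M t \<omega> = m t} \<in> events"
    and "prob {\<omega> \<in> space \<Omega>. \<forall>t\<in>{1..T}. M t \<omega> = m t} \<le> (\<Prod>t=1..T. 1 / real (card (A t)))"
proof -
  \<comment> \<open>\<open>m t\<close> may lie outside the alphabet; then this event is empty, which
    is why the probability is only bounded above.\<close>
  let ?E = "\<lambda>t. M t -` ({m t} \<inter> A t) \<inter> space \<Omega>"
  have E: "{\<omega> \<in> space \<Omega>. \<forall>t\<in>{1..T}. M t \<omega> = m t} = (\<Inter>t\<in>{1..T}. ?E t)"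
    using assms measurable_space[OF message_measurable] by fastforce
  show "{\<omega> \<in> space \<Omega>. \<forall>t\<in>{1..T}. M t \<omega> = m t} \<in> events"
    unfolding E using assms
    by (intro sets.finite_INT measurable_sets[OF message_measurable]) auto
  have pE: "prob (?E t) \<le> 1 / real (card (A t))" if t: "t \<in> {1..T}" for t
  proof -
    have "prob (?E t) = measure (distr \<Omega> (count_space (A t)) (M t)) ({m t} \<inter> A t)"
      using message_measurable[OF t] by (simp add: measure_distr)
    also have "\<dots> = real (card ({m t} \<inter> A t)) / real (card (A t))"
      using alphabet[OF t] by (simp add: message_uniform[OF t] measure_uniform_count_measure)
    also have "\<dots> \<le> 1 / real (card (A t))"
      using card_mono[of "{m t}" "{m t} \<inter> A t"] by (intro divide_right_mono) auto
    finally show ?thesis .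
  qed
  have "prob (\<Inter>t\<in>{1..T}. ?E t) = (\<Prod>t=1..T. prob (?E t))"
    using assms messages_indep by (intro indep_varsD) auto
  also have "\<dots> \<le> (\<Prod>t=1..T. 1 / real (card (A t)))"
    by (intro prod_mono) (use pE in auto)
  finally show "prob {\<omega> \<in> space \<Omega>. \<forall>t\<in>{1..T}. M t \<omega> = m t}
      \<le> (\<Prod>t=1..T. 1 / real (card (A t)))"
    unfolding E .
qed

text \<open>Off the error events, the drops of all cells determine the message tuple. A union bound
  over the drop arrays then applies, as each predicts one tuple and is right with probability at
  most the inverse number of tuples.\<close>

lemma message_count_le:
  assumes "0 < K" "1 \<le> T"
  shows "(1 - (\<Sum>t=1..T. error_prob \<Omega> N M S dec t)) * (\<Prod>t=1..T. real (card (A t)))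
    \<le> real (card (drop_sequences K T)) ^ N"
proof -
  let ?B = "\<lambda>t. {\<omega> \<in> space \<Omega>. dec t (\<lambda>n\<in>{..<N}. S t n \<omega>) \<noteq> M t \<omega>}"
  let ?\<Delta> = "PiE {..<N} (\<lambda>_. drop_sequences K T)"
  \<comment> \<open>The message decoded in round \<open>t\<close> when the states are rebuilt from
    the drop array \<open>\<delta>\<close> through \<open>state_eq\<close>.\<close>
  define m where "m = (\<lambda>\<delta> t. dec t (\<lambda>n\<in>{..<N}. K - 1 - (\<Sum>u<t. \<delta> n u)))"
  let ?F = "\<lambda>\<delta>. {\<omega> \<in> space \<Omega>. \<forall>t\<in>{1..T}. M t \<omega> = m \<delta> t}"
  let ?P = "\<Prod>t=1..T. real (card (A t))"
  have fin: "finite ?\<Delta>" by (intro finite_PiE finite_drop_sequences) auto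
  have B: "(\<Union>t\<in>{1..T}. ?B t) \<in> events"
    by (intro sets.finite_UN error_event_measurable) auto
  have "1 - (\<Sum>t=1..T. error_prob \<Omega> N M S dec t) \<le> 1 - prob (\<Union>t\<in>{1..T}. ?B t)"
    unfolding error_prob_def
    by (intro diff_left_mono finite_measure_subadditive_finite) (auto intro: error_event_measurable)
  also have "\<dots> = prob (space \<Omega> - (\<Union>t\<in>{1..T}. ?B t))"
    using B by (rule prob_compl[symmetric])
  also have "\<dots> \<le> prob (\<Union>\<delta>\<in>?\<Delta>. ?F \<delta>)"
  proof (rule finite_measure_mono)
    show "space \<Omega> - (\<Union>t\<in>{1..T}. ?B t) \<subseteq> (\<Union>\<delta>\<in>?\<Delta>. ?F \<delta>)"
    proof
      fix \<omega> assume \<omega>: "\<omega> \<in> space \<Omega> - (\<Union>t\<in>{1..T}. ?B t)"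
      have "M t \<omega> = m (state_drops \<omega>) t" if t: "t \<in> {1..T}" for t
      proof -
        have "M t \<omega> = dec t (\<lambda>n\<in>{..<N}. S t n \<omega>)" using \<omega> t by auto
        also have "(\<lambda>n\<in>{..<N}. S t n \<omega>) =
            (\<lambda>n\<in>{..<N}. K - 1 - (\<Sum>u<t. state_drops \<omega> n u))"
          using \<omega> t by (intro restrict_ext state_eq) auto
        finally show ?thesis by (simp only: m_def)
      qed
      then have "\<omega> \<in> ?F (state_drops \<omega>)" using \<omega> by auto
      then show "\<omega> \<in> (\<Union>\<delta>\<in>?\<Delta>. ?F \<delta>)"
        using state_drops_in[OF assms(1), of \<omega>] \<omega> by blast
    qed
    show "(\<Union>\<delta>\<in>?\<Delta>. ?F \<delta>) \<in> events"
      using fin prob_messages_eq_le(1)[OF assms(2)] by (intro sets.finite_UN) auto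
  qed
  also have "\<dots> \<le> (\<Sum>\<delta>\<in>?\<Delta>. prob (?F \<delta>))"
    using fin prob_messages_eq_le(1)[OF assms(2)]
    by (intro finite_measure_subadditive_finite) auto
  also have "\<dots> \<le> (\<Sum>\<delta>\<in>?\<Delta>. 1 / ?P)"
    using prob_messages_eq_le(2)[OF assms(2)] by (intro sum_mono) (simp add: prod_dividef)
  also have "\<dots> = real (card (drop_sequences K T)) ^ N / ?P"
    by (simp add: card_PiE)
  finally have le: "1 - (\<Sum>t=1..T. error_prob \<Omega> N M S dec t)
      \<le> real (card (drop_sequences K T)) ^ N / ?P" .
  have "0 < ?P"
    using alphabet by (intro prod_pos) (auto simp: card_gt_0_iff)
  with le show ?thesis by (simp only: pos_le_divide_eq)
qed

lemma sum_data_rate_le: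
  assumes "0 < K" "1 \<le> T" "0 \<le> \<beta>" and err: "(\<Sum>t=1..T. error_prob \<Omega> N M S dec t) < 1"
  shows "ln (1 - (\<Sum>t=1..T. error_prob \<Omega> N M S dec t)) + (\<Sum>t=1..T. data_rate N A t) * ln 2
    \<le> \<beta> * real (K - 1) + real T * ln (partition_fun K \<beta>)"
proof -
  let ?e = "\<Sum>t=1..T. error_prob \<Omega> N M S dec t"
  let ?C = "exp (\<beta> * real (K - 1)) * partition_fun K \<beta> ^ T"
  let ?P = "\<Prod>t=1..T. real (card (A t))"
  have Z: "0 < partition_fun K \<beta>" using assms(1) by (rule partition_fun_pos)
  have A: "0 < real (card (A t))" if "t \<in> {1..T}" for t
    using alphabet[OF that] by (simp add: card_gt_0_iff)
  have P: "0 < ?P" by (intro prod_pos) (use A in auto)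
  have e: "0 \<le> ?e" by (intro sum_nonneg) (simp add: error_prob_def)
  have N: "1 \<le> real N" using cells by simp
  have "(1 - ?e) * ?P \<le> ?C ^ N"
    using message_count_le[OF assms(1,2), of dec] card_drop_sequences_le[OF assms(3), of K T]
    by (meson order_trans power_mono of_nat_0_le_iff)
  then have "ln ((1 - ?e) * ?P) \<le> ln (?C ^ N)"
    using P err Z by (intro ln_mono) auto
  moreover have "ln ?P = real N * ((\<Sum>t=1..T. data_rate N A t) * ln 2)"
  proof -
    have "ln ?P = (\<Sum>t=1..T. ln (real (card (A t))))"
      by (rule ln_prod) (use A in auto)
    then show ?thesis
      using cells by (simp add: data_rate_def log_def sum_divide_distrib[symmetric])
  qed
  moreover have "ln (?C ^ N) = real N * (\<beta> * real (K - 1) + real T * ln (partition_fun K \<beta>))"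
    using Z by (simp add: ln_realpow ln_mult)
  \<comment> \<open>The logarithm is at most 0, so a factor \<open>N \<ge> 1\<close> can only lower
    it. This lets \<open>N\<close> cancel and leaves a bound free of the block length.\<close>
  moreover have "real N * ln (1 - ?e) \<le> ln (1 - ?e)"
    using N e err mult_right_mono_neg[of 1 "real N" "ln (1 - ?e)"] by simp
  moreover have "ln ((1 - ?e) * ?P) = ln (1 - ?e) + ln ?P"
    using P err by (intro ln_mult_pos) auto
  ultimately have "real N * (ln (1 - ?e) + (\<Sum>t=1..T. data_rate N A t) * ln 2)
      \<le> real N * (\<beta> * real (K - 1) + real T * ln (partition_fun K \<beta>))"
    unfolding distrib_left by linarith
  then show ?thesis using N by simp
qed

end

section \<open>Limit of vanishing error and the coding efficiency\<close>

lemma reliably_used_rate_bound: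
  assumes "0 < K" "1 \<le> T" "0 \<le> \<beta>" "reliably_used K T \<Omega> N A M S dec l"
  shows "(\<Sum>t=1..T. l t) * ln 2 \<le> \<beta> * real (K - 1) + real T * ln (partition_fun K \<beta>)"
proof -
  let ?e = "\<lambda>i. \<Sum>t=1..T. error_prob (\<Omega> i) (N i) (M i) (S i) (dec i) t"
  let ?r = "\<lambda>i. \<Sum>t=1..T. data_rate (N i) (A i) t"
  have "?e \<longlonglongrightarrow> (\<Sum>t=1..T. 0)"
    using assms(4) by (intro tendsto_sum) (auto simp: reliably_used_def)
  then have e: "?e \<longlonglongrightarrow> 0" by simp
  have r: "?r \<longlonglongrightarrow> (\<Sum>t=1..T. l t)"
    using assms(4) by (intro tendsto_sum) (auto simp: reliably_used_def)
  have "(\<lambda>i. ln (1 - ?e i) + ?r i * ln 2) \<longlonglongrightarrow> ln (1 - 0) + (\<Sum>t=1..T. l t) * ln 2"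
    by (intro tendsto_intros e r) auto
  then have lim: "(\<lambda>i. ln (1 - ?e i) + ?r i * ln 2) \<longlonglongrightarrow> (\<Sum>t=1..T. l t) * ln 2" by simp
  \<comment> \<open>The single-block bound requires total error below 1, which holds from some index
    on; the limit then removes the error term.\<close>
  have "\<forall>\<^sub>F i in sequentially. ?e i < 1"
    using e by (rule order_tendstoD) simp
  then have "\<forall>\<^sub>F i in sequentially. ln (1 - ?e i) + ?r i * ln 2
      \<le> \<beta> * real (K - 1) + real T * ln (partition_fun K \<beta>)"
  proof eventually_elim
    case (elim i)
    have "memory_block_use (\<Omega> i) (N i) K T (A i) (M i) (S i)"
      using assms(4) by (simp add: reliably_used_def)
    then show ?case
      using assms(1-3) elim by (rule memory_block_use.sum_data_rate_le)
  qed
  with lim show ?thesis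
    by (intro tendsto_upperbound) auto
qed

text \<open>Expressing the payload through \<open>rate_eq\<close> turns the rate bound into a bound
  on the cost, since the logarithms of the partition function cancel and \<beta> is
  positive.\<close>

lemma cost_le_of_reliably_used:
  assumes "0 < K" "1 \<le> T" "0 < \<beta>"
    and "reliably_used K T \<Omega> N A M S dec l" "payload T l = rate K \<beta>"
  shows "real T * cost K \<beta> \<le> real (K - 1)"
proof -
  have l: "(\<Sum>t=1..T. l t) = real T * rate K \<beta>"
    using assms(2,5) by (simp add: payload_def field_simps)
  have "\<beta> * (real T * cost K \<beta>) + real T * ln (partition_fun K \<beta>) = (\<Sum>t=1..T. l t) * ln 2"
    unfolding l using arg_cong[OF rate_eq[OF assms(1), of \<beta>], of "(*) (real T)"]
    by (simp add: algebra_simps)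
  also have "\<dots> \<le> \<beta> * real (K - 1) + real T * ln (partition_fun K \<beta>)"
    using assms by (intro reliably_used_rate_bound) auto
  finally show ?thesis using assms(3) by simp
qed

lemma coding_efficiency_le:
  assumes "2 \<le> K" "1 \<le> T" "0 \<le> \<alpha>" "0 < \<beta>" "0 \<le> rate K \<beta>"
    and "reliably_used K T \<Omega> N A M S dec l" "payload T l = rate K \<beta>"
  shows "coding_efficiency \<alpha> K T l \<le> \<alpha> * rate K \<beta> / cost K \<beta>"
proof -
  have "real T * cost K \<beta> \<le> real (K - 1)"
    using assms by (intro cost_le_of_reliably_used) auto
  \<comment> \<open>The bound \<open>K - 1\<close> is weakened to \<open>K\<close>, the
    normalization in the coding efficiency.\<close>
  then have T: "real T / real K \<le> 1 / cost K \<beta>"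
    using assms(1) cost_pos[OF assms(1), of \<beta>] by (simp add: field_simps)
  have "coding_efficiency \<alpha> K T l = \<alpha> * rate K \<beta> * (real T / real K)"
    using assms(1,2,7) by (simp add: coding_efficiency_def payload_def field_simps)
  also have "\<dots> \<le> \<alpha> * rate K \<beta> * (1 / cost K \<beta>)"
    using T assms(3,5) by (intro mult_left_mono) auto
  finally show ?thesis by simp
qed

theorem mainTheorem3:
  fixes K T :: nat and p \<alpha> :: real
    and \<Omega> :: "nat \<Rightarrow> 'a measure" and N :: "nat \<Rightarrow> nat" and A :: "nat \<Rightarrow> nat \<Rightarrow> 'm set"
    and M :: "nat \<Rightarrow> nat \<Rightarrow> 'a \<Rightarrow> 'm" and S :: "nat \<Rightarrow> nat \<Rightarrow> nat \<Rightarrow> 'a \<Rightarrow> nat"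
    and dec :: "nat \<Rightarrow> nat \<Rightarrow> (nat \<Rightarrow> nat) \<Rightarrow> 'm" and l :: "nat \<Rightarrow> real"
  assumes "2 \<le> K" and "1 \<le> T" and "0 \<le> \<alpha>"
  shows "(0 < p \<and> p < log 2 (real K) \<longrightarrow>
            (\<exists>V. optimal K T p V) \<and>
            (\<forall>V. optimal K T p V \<longrightarrow> (\<exists>b. \<forall>t\<in>{1..T}. 0 < b t \<and> V t = gibbs K (b t)))) \<and>
         (\<forall>V b. optimal K T p V \<and> (\<forall>t\<in>{1..T}. 0 < b t \<and> V t = gibbs K (b t)) \<longrightarrow>
            (\<exists>\<beta>>0. (\<forall>t\<in>{1..T}. b t = \<beta>) \<and>
                 (reliably_used K T \<Omega> N A M S dec l \<and> payload T l = p \<longrightarrow>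
                    coding_efficiency \<alpha> K T l \<le> \<alpha> * rate K \<beta> / cost K \<beta>)))"
proof (intro conjI impI allI)
  have K: "0 < K" using assms(1) by simp
  show "\<exists>V. optimal K T p V" if "0 < p \<and> p < log 2 (real K)"
    using ex_rate_eq[OF assms(1), of p] optimal_const_gibbs[OF K] that by blast
  show "\<exists>b. \<forall>t\<in>{1..T}. 0 < b t \<and> V t = gibbs K (b t)"
    if p: "0 < p \<and> p < log 2 (real K)" and V: "optimal K T p V" for V
  proof -
    obtain \<beta> where \<beta>: "0 < \<beta>" "rate K \<beta> = p"
      using ex_rate_eq[OF assms(1), of p] p by blast
    then show ?thesis
      using optimal_imp_gibbs[OF K \<beta> V] by (intro exI[of _ "\<lambda>_. \<beta>"]) simp
  qed
  fix V b assume V: "optimal K T p V \<and> (\<forall>t\<in>{1..T}. 0 < b t \<and> V t = gibbs K (b t))"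
  have p: "0 < p" "p < log 2 (real K)"
    using optimal_gibbs_imp_payload_pos[OF assms(1,2), of p V b]
      optimal_gibbs_imp_payload_less[OF assms(1,2), of p V b] V by auto
  then obtain \<beta> where \<beta>: "0 < \<beta>" "rate K \<beta> = p"
    using ex_rate_eq[OF assms(1)] by blast
  \<comment> \<open>\<open>V t\<close> is the Gibbs law of \<open>b t\<close> by assumption and that
    of \<beta> by uniqueness of the optimum, so injectivity identifies the parameters.\<close>
  have "b t = \<beta>" if "t \<in> {1..T}" for t
    using optimal_imp_gibbs[OF K \<beta> _ that, of V] V that
    by (intro gibbs_inject[OF assms(1)]) auto
  moreover have "coding_efficiency \<alpha> K T l \<le> \<alpha> * rate K \<beta> / cost K \<beta>"
    if "reliably_used K T \<Omega> N A M S dec l \<and> payload T l = p"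
    using that \<beta> p by (intro coding_efficiency_le assms) auto
  ultimately show "\<exists>\<beta>>0. (\<forall>t\<in>{1..T}. b t = \<beta>) \<and>
      (reliably_used K T \<Omega> N A M S dec l \<and> payload T l = p \<longrightarrow>
         coding_efficiency \<alpha> K T l \<le> \<alpha> * rate K \<beta> / cost K \<beta>)"
    using \<beta>(1) by blast
qed

end
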